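(* The entire function $D$ (the Floquet discriminant of $\mathfrak a$) is not a constant.
   Context: Let $a>0$ and let $w,p,q:\mathbb R\to\mathbb R$ be measurable and $a$-periodic, with $w,q,p^{-1}$ integrable over $(0,a)$, $w\neq0$ a.e. and $p>0$ a.e. ($w$ may change sign). Put $\mathfrak a(f):=\frac1w\big(-(pf')'+qf\big)$. For $\lambda\in\mathbb C$ let $\varphi_\lambda,\psi_\lambda$ be the solutions of $\mathfrak a(u)=\lambda u$ with $\varphi_\lambda(0)=1$, $(p\varphi_\lambda')(0)=0$, $\psi_\lambda(0)=0$, $(p\psi_\lambda')(0)=1$. The Floquet discriminant of $\mathfrak a$ is the entire function $D(\lambda):=\varphi_\lambda(a)+(p\psi_\lambda')(a)$. *)

theory Defs
  imports "HOL-Analysis.Analysis"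
begin

(* The classical epsilon-delta notion. The members of a division are nonempty compact intervals
   with pairwise disjoint interiors, so K is the interval {Inf K..Sup K}; degenerate members
   contribute nothing to either sum. *)
definition abs_continuous_on :: "real set \<Rightarrow> (real \<Rightarrow> 'a::real_normed_vector) \<Rightarrow> bool" where
  "abs_continuous_on S f \<longleftrightarrow>
     (\<forall>\<epsilon>>0. \<exists>\<delta>>0. \<forall>d T. d division_of T \<and> T \<subseteq> S \<and> (\<Sum>K\<in>d. Sup K - Inf K) < \<delta> \<longrightarrow>
        (\<Sum>K\<in>d. norm (f (Sup K) - f (Inf K))) < \<epsilon>)"

(* u solves (1/w) (-(p u')' + q u) = lam u on the real line in the Caratheodory sense.
   The product of p and u' is only determined almost everywhere; the argument pu' is its
   absolutely continuous (hence unique) representative, and it is the values of pu' that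
   expressions such as (p u')(0) refer to. *)
definition sl_solution ::
  "(real \<Rightarrow> real) \<Rightarrow> (real \<Rightarrow> real) \<Rightarrow> (real \<Rightarrow> real) \<Rightarrow> complex \<Rightarrow>
   (real \<Rightarrow> complex) \<Rightarrow> (real \<Rightarrow> complex) \<Rightarrow> bool" where
  "sl_solution w p q lam u pu' \<longleftrightarrow>
     (\<forall>c d. abs_continuous_on {c..d} u) \<and>
     (\<forall>c d. abs_continuous_on {c..d} pu') \<and>
     (AE x in lebesgue. \<exists>u'. (u has_vector_derivative u') (at x) \<and>
        pu' x = of_real (p x) * u') \<and>
     (AE x in lebesgue. \<exists>v'. (pu' has_vector_derivative v') (at x) \<and>
        of_real (1 / w x) * (- v' + of_real (q x) * u x) = lam * u x)"

end

(* If D were the constant c, fix a root rho of rho^2 - c rho + 1. Since the monodromy matrix has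
   determinant 1, for every lam = i tau there is a nonzero solution u with multiplier rho, which we
   normalise by max |u| = 1 on [0, a]. The real part of the energy identity
   (v cnj u)' = |v|^2 / p + (q - i tau w) |u|^2, where v = p u', does not see tau, so it bounds the
   integral of |v|^2 / p uniformly in tau. Hence the u are equicontinuous and, along a sequence
   tau -> infinity, converge uniformly to some g with max |g| = 1. Dividing v' = (q - i tau w) u by tau
   shows that w g = 0 almost everywhere, whence g = 0, a contradiction. *)
theory Submission
  imports Defs "HOL-Complex_Analysis.Great_Picard"
begin

text \<open>The real part of the energy identity is useful because \<open>w\<close> is real: for
  \<open>lam\<close> on the imaginary axis the term with \<open>w * |u|^2\<close> is purely
  imaginary, whatever the sign of \<open>w\<close>. The constancy of \<open>D\<close> enters through
  \<open>\<rho>\<close>: the energy bound degenerates as \<open>|\<rho>|\<close> tends to 0 or to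
  infinity, and it is uniform in \<open>\<tau>\<close> because one multiplier serves all
  \<open>\<tau>\<close>. The obstacle in the last step is that \<open>v\<close> has no pointwise
  bound uniform in \<open>\<tau>\<close>; only the integral of \<open>|v|^2 / p\<close> is
  controlled. The equation, integrated between two fixed end points, therefore cannot simply be
  divided by \<open>\<tau>\<close>. Instead one end point is put where \<open>|v|\<close> is so
  small that the energy controls it, and the other is averaged against the weight
  \<open>1 / p\<close>. Hence the primitive of \<open>w * g\<close> is close, in weighted mean, to
  its own value at some point. Compactness of the period makes this primitive constant, and as it
  starts at 0 it vanishes.\<close>

subsection \<open>Absolutely continuous functions\<close>

text \<open>Tagged intervals with tags in the exceptional set are kept inside an open set of small measure,
  where absolute continuity bounds the total increment of \<open>f\<close>.\<close>

lemma abs_continuous_on_has_integral: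
  fixes f :: "real \<Rightarrow> 'a::banach"
  assumes ab: "a \<le> b" and ac: "abs_continuous_on {a..b} f" and E: "negligible E"
    and der: "\<And>x. x \<in> {a..b} - E \<Longrightarrow> (f has_vector_derivative f' x) (at x within {a..b})"
  shows "(f' has_integral (f b - f a)) {a..b}"
proof -
  define g where "g = (\<lambda>x. if x \<in> E then 0 else f' x)"
  have "(g has_integral (f b - f a)) {a..b}"
    unfolding has_integral_real
  proof (intro allI impI)
    fix e :: real
    assume e: "e > 0"
    \<comment> \<open>The summand 1 in the denominator covers the case \<open>a = b\<close>.\<close>
    define e1 where "e1 = e / (2 * (b - a + 1))"
    have e1: "e1 > 0" "e1 * (b - a) \<le> e / 2"
      using e ab by (auto simp: e1_def field_simps)
    obtain \<delta> where \<delta>: "\<delta> > 0"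
      and ac\<delta>: "\<And>d T. \<lbrakk>d division_of T; T \<subseteq> {a..b}; (\<Sum>K\<in>d. Sup K - Inf K) < \<delta>\<rbrakk>
            \<Longrightarrow> (\<Sum>K\<in>d. norm (f (Sup K) - f (Inf K))) < e / 2"
      using ac e unfolding abs_continuous_on_def by (metis half_gt_zero)
    obtain U where U: "open U" "E \<subseteq> U" "U \<in> lmeasurable" "measure lebesgue U < \<delta>"
    proof -
      obtain U where U: "open U" "E \<subseteq> U" "U - E \<in> lmeasurable" "emeasure lebesgue (U - E) < ennreal \<delta>"
        using sets_lebesgue_outer_open[OF negligible_imp_sets[OF E] \<delta>] by blast
      have "U \<in> lmeasurable \<and> measure lebesgue U = measure lebesgue (U - E)"
        using U E by (metis Un_Diff_cancel2 measure_Un_null_set negligible_iff_null_sets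
            negligible_imp_measurable fmeasurable.Un sup.absorb_iff1 fmeasurableD)
      moreover have "measure lebesgue (U - E) < \<delta>"
        using U(3,4) \<delta> by (simp add: emeasure_eq_measure2 ennreal_less_iff)
      ultimately show thesis using U that by metis
    qed
    have "\<exists>\<rho>>0. (x \<in> E \<longrightarrow> ball x \<rho> \<subseteq> U) \<and> (x \<in> {a..b} - E \<longrightarrow>
          (\<forall>y\<in>{a..b}. norm (y - x) < \<rho> \<longrightarrow> norm (f y - f x - (y - x) *\<^sub>R f' x) \<le> e1 * norm (y - x)))" for x
    proof (cases "x \<in> E")
      case True
      then show ?thesis using U openE by blast
    next
      case False
      show ?thesis
      proof (cases "x \<in> {a..b}")
        case True
        then show ?thesis using der[of x] False e1(1)
          unfolding has_vector_derivative_def has_derivative_within_alt by blast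
      qed (use False in \<open>auto intro: exI[of _ 1]\<close>)
    qed
    then obtain \<rho> where \<rho>: "\<And>x. \<rho> x > 0" "\<And>x. x \<in> E \<Longrightarrow> ball x (\<rho> x) \<subseteq> U"
      "\<And>x y. \<lbrakk>x \<in> {a..b} - E; y \<in> {a..b}; norm (y - x) < \<rho> x\<rbrakk>
          \<Longrightarrow> norm (f y - f x - (y - x) *\<^sub>R f' x) \<le> e1 * norm (y - x)"
      by metis
    show "\<exists>\<gamma>. gauge \<gamma> \<and> (\<forall>\<D>. \<D> tagged_division_of {a..b} \<and> \<gamma> fine \<D> \<longrightarrow>
            norm ((\<Sum>(x, k)\<in>\<D>. measure lborel k *\<^sub>R g x) - (f b - f a)) < e)"
    proof (intro exI[of _ "\<lambda>x. ball x (\<rho> x)"] conjI allI impI gauge_ball_dependent \<rho>(1))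
      fix p
      assume "p tagged_division_of {a..b} \<and> (\<lambda>x. ball x (\<rho> x)) fine p"
      then have p: "p tagged_division_of {a..b}" and fine: "(\<lambda>x. ball x (\<rho> x)) fine p" by auto
      have finp: "finite p" using p by blast
      define pE where "pE = {(x,K) \<in> p. x \<in> E}"
      define h where "h = (\<lambda>(x,K). measure lborel K *\<^sub>R g x - (f (Sup K) - f (Inf K)))"
      have fb: "f b - f a = (\<Sum>(x,K)\<in>p. f (Sup K) - f (Inf K))"
        using additive_tagged_division_1[OF ab p, of f] by simp
      have ba: "b - a = (\<Sum>(x,K)\<in>p. Sup K - Inf K)"
        using additive_tagged_division_1[OF ab p, of "\<lambda>x. x"] by simp
      have K: "\<exists>u v. K = {u..v} \<and> a \<le> u \<and> u \<le> x \<and> x \<le> v \<and> v \<le> b \<and> u \<in> ball x (\<rho> x) \<and> v \<in> ball x (\<rho> x) \<and>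
          K \<subseteq> ball x (\<rho> x)"
        if xK: "(x,K) \<in> p" for x K
      proof -
        obtain u v where "K = cbox u v" using tagged_division_ofD(4)[OF p xK] by blast
        moreover have "x \<in> K" "K \<subseteq> {a..b}" using tagged_division_ofD(2,3)[OF p xK] by auto
        moreover have "K \<subseteq> ball x (\<rho> x)" using fine xK unfolding fine_def by blast
        moreover have "u \<in> K" "v \<in> K" using calculation by auto
        ultimately show ?thesis
          by (intro exI[of _ u] exI[of _ v]) (auto simp del: mem_ball)
      qed
      have pEp: "pE \<subseteq> p" by (auto simp: pE_def)
      have tp: "pE tagged_partial_division_of {a..b}"
        using tagged_partial_division_subset[OF _ pEp] p by (simp add: tagged_division_of_def)
      have dE: "snd ` pE division_of \<Union>(snd ` pE)" 
        using partial_division_of_tagged_division[OF tp] .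
      have sumE: "(\<Sum>(x,K)\<in>pE. norm (f (Sup K) - f (Inf K))) = (\<Sum>K\<in>snd ` pE. norm (f (Sup K) - f (Inf K)))"
      proof -
        \<comment> \<open>\<open>sum.over_tagged_division_lemma\<close> needs a summand that
          vanishes on every \<open>cbox u v\<close> with empty interior. This includes the empty
          set, where \<open>Sup\<close> and \<open>Inf\<close> carry no information; hence the case
          distinction.\<close>
        define d where "d = (\<lambda>K::real set. if K = {} then 0 else norm (f (Sup K) - f (Inf K)))"
        have "(\<Sum>(x,K)\<in>pE. d K) = (\<Sum>K\<in>snd ` pE. d K)"
        proof (rule sum.over_tagged_division_lemma[OF tagged_partial_division_of_Union_self[OF tp]])
          show "d (cbox u v) = 0" if "box u v = {}" for u v
            using that by (cases "u = v") (auto simp: d_def)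
        qed
        moreover have "(\<Sum>(x,K)\<in>pE. d K) = (\<Sum>(x,K)\<in>pE. norm (f (Sup K) - f (Inf K)))"
          using K pEp by (intro sum.cong) (fastforce simp: d_def)+
        moreover have "(\<Sum>K\<in>snd ` pE. d K) = (\<Sum>K\<in>snd ` pE. norm (f (Sup K) - f (Inf K)))"
          using K pEp by (intro sum.cong) (fastforce simp: d_def)+
        ultimately show ?thesis by simp
      qed
      have "(\<Sum>K\<in>snd ` pE. Sup K - Inf K) = (\<Sum>K\<in>snd ` pE. measure lebesgue K)"
        using K pEp by (intro sum.cong) fastforce+
      also have "\<dots> = measure lebesgue (\<Union>(snd ` pE))"
        using content_division[OF dE] .
      also have "\<dots> \<le> measure lebesgue U"
      proof (rule measure_mono_fmeasurable)
        show "\<Union>(snd ` pE) \<subseteq> U" using K \<rho>(2) by (fastforce simp: pE_def)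
        show "\<Union>(snd ` pE) \<in> sets lebesgue" using lmeasurable_division[OF dE] by blast
      qed (use U in auto)
      finally have "(\<Sum>K\<in>snd ` pE. norm (f (Sup K) - f (Inf K))) < e / 2"
        using K pEp U(4) by (intro ac\<delta>[OF dE]) fastforce+
      then have 1: "norm (\<Sum>z\<in>pE. h z) < e / 2"
      proof -
        have "norm (\<Sum>z\<in>pE. h z) \<le> (\<Sum>z\<in>pE. norm (h z))" by (rule norm_sum)
        also have "\<dots> = (\<Sum>(x,K)\<in>pE. norm (f (Sup K) - f (Inf K)))"
          by (intro sum.cong) (auto simp: h_def pE_def g_def norm_minus_commute)
        finally show ?thesis using sumE \<open>(\<Sum>K\<in>snd ` pE. norm (f (Sup K) - f (Inf K))) < e / 2\<close> by linarith
      qed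
      have 2: "norm (\<Sum>z\<in>p - pE. h z) \<le> e / 2"
      proof -
        have "norm (\<Sum>z\<in>p - pE. h z) \<le> (\<Sum>(x,K)\<in>p - pE. e1 * (Sup K - Inf K))"
        proof (rule sum_norm_le)
          fix z assume z: "z \<in> p - pE"
          obtain x L where xL: "z = (x,L)" by force
          then have xp: "(x,L) \<in> p" "x \<notin> E" using z by (auto simp: pE_def)
          obtain u v where uv: "L = {u..v}" "a \<le> u" "u \<le> x" "x \<le> v" "v \<le> b" "u \<in> ball x (\<rho> x)" "v \<in> ball x (\<rho> x)"
            using K[OF xp(1)] by blast
          \<comment> \<open>Splitting the increment over \<open>L\<close> at the tag leaves two
            linearisation errors. As \<open>x\<close> lies between \<open>u\<close> and
            \<open>v\<close>, their bounds add up to \<open>e1\<close> times the length of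
            \<open>L\<close>.\<close>
          have "norm (h z) = norm ((f u - f x - (u - x) *\<^sub>R f' x) - (f v - f x - (v - x) *\<^sub>R f' x))"
            using uv xp by (simp add: h_def xL g_def algebra_simps)
          also have "\<dots> \<le> norm (f u - f x - (u - x) *\<^sub>R f' x) + norm (f v - f x - (v - x) *\<^sub>R f' x)"
            by (rule norm_triangle_ineq4)
          also have "\<dots> \<le> e1 * norm (u - x) + e1 * norm (v - x)"
            using uv xp by (intro add_mono \<rho>(3)) (auto simp: dist_real_def)
          also have "\<dots> = e1 * (Sup L - Inf L)" using uv by (simp add: algebra_simps)
          finally show "norm (h z) \<le> (case z of (x,K) \<Rightarrow> e1 * (Sup K - Inf K))" by (simp add: xL)
        qed
        also have "\<dots> \<le> (\<Sum>(x,K)\<in>p. e1 * (Sup K - Inf K))"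
          using K e1(1) by (intro sum_mono2 finp) fastforce+
        also have "\<dots> = e1 * (b - a)" unfolding ba by (simp add: sum_distrib_left case_prod_unfold)
        finally show ?thesis using e1 by linarith
      qed
      have "(\<Sum>(x, k)\<in>p. measure lborel k *\<^sub>R g x) - (f b - f a) = (\<Sum>z\<in>p. h z)"
        unfolding fb h_def by (simp add: sum_subtractf[symmetric] case_prod_unfold)
      also have "\<dots> = (\<Sum>z\<in>p - pE. h z) + (\<Sum>z\<in>pE. h z)"
        by (rule sum.subset_diff[OF pEp finp])
      finally have eq: "(\<Sum>(x, k)\<in>p. measure lborel k *\<^sub>R g x) - (f b - f a)
          = (\<Sum>z\<in>p - pE. h z) + (\<Sum>z\<in>pE. h z)" .
      show "norm ((\<Sum>(x, k)\<in>p. measure lborel k *\<^sub>R g x) - (f b - f a)) < e"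
        unfolding eq using 1 2 norm_triangle_ineq[of "\<Sum>z\<in>p - pE. h z" "\<Sum>z\<in>pE. h z"] by linarith
    qed
  qed
  then show ?thesis
    by (rule has_integral_spike[OF E, rotated]) (auto simp: g_def)
qed

section \<open>Null sets and vanishing integrals\<close>

lemma AE_imp_negligible:
  assumes "AE x in lebesgue. P x"
  shows "negligible {x. \<not> P x}"
proof -
  obtain N where "N \<in> null_sets lebesgue" "{x. \<not> P x} \<subseteq> N"
    using assms unfolding eventually_ae_filter by auto
  then show ?thesis using negligible_iff_null_sets negligible_subset by blast
qed

text \<open>For a nonnegative function the gauge integral agrees with the nonnegative Lebesgue
  integral, and the latter vanishes only if the function is zero almost everywhere.\<close>

lemma has_integral_zero_imp_negligible:
  fixes f :: "real \<Rightarrow> real"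
  assumes "(f has_integral 0) S" and nn: "\<And>x. x \<in> S \<Longrightarrow> f x \<ge> 0"
  shows "negligible {x \<in> S. f x \<noteq> 0}"
proof -
  define g where "g = (\<lambda>x. if x \<in> S then f x else 0)"
  have "(g has_integral 0) UNIV"
    using assms(1) by (simp add: g_def has_integral_restrict_UNIV)
  then have "g \<in> borel_measurable lebesgue" "integral\<^sup>N lebesgue g = 0"
    using has_integral_iff_nn_integral_lebesgue[of g 0] nn by (auto simp: g_def)
  then have "AE x in lebesgue. ennreal (g x) = 0"
    by (subst (asm) nn_integral_0_iff_AE) auto
  then have "negligible {x. \<not> ennreal (g x) = 0}"
    by (rule AE_imp_negligible)
  then show ?thesis
    by (rule negligible_subset) (use nn in \<open>fastforce simp: g_def ennreal_eq_0_iff\<close>)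
qed

text \<open>By Henstock's lemma the Riemann sums of \<open>norm f\<close> are small when all integrals of \<open>f\<close> vanish.\<close>

lemma integral_zero_imp_negligible:
  fixes f :: "real \<Rightarrow> 'a::euclidean_space"
  assumes f: "f integrable_on {a..b}" and 0: "\<And>x. x \<in> {a..b} \<Longrightarrow> integral {a..x} f = 0"
  shows "negligible {x \<in> {a..b}. f x \<noteq> 0}"
proof -
  have sub: "integral {u..v} f = 0" if "a \<le> u" "u \<le> v" "v \<le> b" for u v
  proof -
    have "integral {a..u} f + integral {u..v} f = integral {a..v} f"
      using that f by (intro Henstock_Kurzweil_Integration.integral_combine)
        (auto intro: integrable_subinterval_real)
    then show ?thesis using 0[of u] 0[of v] that by auto
  qed
  have "((\<lambda>x. norm (f x)) has_integral 0) {a..b}"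
    unfolding has_integral_real
  proof (intro allI impI)
    fix e :: real
    assume e: "e > 0"
    have fi: "f integrable_on cbox a b" using f by simp
    obtain \<gamma> where \<gamma>: "gauge \<gamma>"
      "\<And>p. \<lbrakk>p tagged_partial_division_of (cbox a b); \<gamma> fine p\<rbrakk> \<Longrightarrow>
             sum (\<lambda>(x,k). norm (measure lborel k *\<^sub>R f x - integral k f)) p < e"
      by (rule Henstock_lemma[OF fi e]) blast
    show "\<exists>\<gamma>. gauge \<gamma> \<and> (\<forall>\<D>. \<D> tagged_division_of {a..b} \<and> \<gamma> fine \<D> \<longrightarrow>
            norm ((\<Sum>(x, k)\<in>\<D>. measure lborel k *\<^sub>R norm (f x)) - 0) < e)"
    proof (intro exI[of _ \<gamma>] conjI allI impI \<gamma>(1))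
      fix p
      assume "p tagged_division_of {a..b} \<and> \<gamma> fine p"
      then have p: "p tagged_division_of {a..b}" and fine: "\<gamma> fine p" by auto
      have "(\<Sum>(x, k)\<in>p. measure lborel k *\<^sub>R norm (f x)) = (\<Sum>(x, k)\<in>p. norm (measure lborel k *\<^sub>R f x - integral k f))"
      proof (rule sum.cong[OF refl], clarify)
        fix x K assume xK: "(x,K) \<in> p"
        obtain u v where K: "K = cbox u v" using tagged_division_ofD(4)[OF p xK] by blast
        have "x \<in> K" "K \<subseteq> {a..b}" using tagged_division_ofD(2,3)[OF p xK] by auto
        then have "integral K f = 0" using K by (auto intro!: sub)
        then show "measure lborel K *\<^sub>R norm (f x) = norm (measure lborel K *\<^sub>R f x - integral K f)" by simp
      qed
      also have "\<dots> < e"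
        using \<gamma>(2)[of p] p fine by (simp add: tagged_division_of_def)
      finally show "norm ((\<Sum>(x, k)\<in>p. measure lborel k *\<^sub>R norm (f x)) - 0) < e"
        by (simp add: sum_nonneg case_prod_unfold)
    qed
  qed
  then have "negligible {x \<in> {a..b}. norm (f x) \<noteq> 0}"
    by (rule has_integral_zero_imp_negligible) auto
  then show ?thesis by simp
qed

section \<open>Closure properties of absolute continuity\<close>

lemma abs_continuous_on_imp_continuous_on:
  fixes f :: "real \<Rightarrow> 'a::real_normed_vector"
  assumes ac: "abs_continuous_on {a..b} f"
  shows "continuous_on {a..b} f"
  unfolding continuous_on_iff
proof (intro ballI allI impI)
  fix x e :: real
  assume x: "x \<in> {a..b}" and e: "e > 0"
  obtain \<delta> where \<delta>: "\<delta> > 0"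
      and ac\<delta>: "\<And>d T. \<lbrakk>d division_of T; T \<subseteq> {a..b}; (\<Sum>K\<in>d. Sup K - Inf K) < \<delta>\<rbrakk>
            \<Longrightarrow> (\<Sum>K\<in>d. norm (f (Sup K) - f (Inf K))) < e"
      using ac e unfolding abs_continuous_on_def by metis
  have *: "norm (f v - f u) < e" if "u \<le> v" "u \<in> {a..b}" "v \<in> {a..b}" "v - u < \<delta>" for u v
    using ac\<delta>[of "{{u..v}}" "{u..v}"] that division_of_self[of u v] by auto
  show "\<exists>d>0. \<forall>y\<in>{a..b}. dist y x < d \<longrightarrow> dist (f y) (f x) < e"
  proof (intro exI[of _ \<delta>] conjI ballI impI \<delta>)
    fix y assume "y \<in> {a..b}" "dist y x < \<delta>"
    then show "dist (f y) (f x) < e"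
      using *[of x y] *[of y x] x by (cases "x \<le> y") (auto simp: dist_norm norm_minus_commute)
  qed
qed

text \<open>The common device behind sums, products, conjugates and multiples: it reduces each of
  them to a pointwise estimate of one increment. With two controlling functions, each may use up
  \<open>e / (2 * C)\<close>.\<close>

lemma abs_continuous_on_dominated:
  assumes f: "abs_continuous_on S f" and g: "abs_continuous_on S g"
    and le: "\<And>x y. x \<in> S \<Longrightarrow> y \<in> S \<Longrightarrow> norm (h x - h y) \<le> C * (norm (f x - f y) + norm (g x - g y))"
    and C: "C > 0"
  shows "abs_continuous_on S h"
  unfolding abs_continuous_on_def
proof (intro allI impI)
  fix e :: real
  assume "e > 0"
  then have e: "e / (2 * C) > 0" using C by simp
  obtain \<delta>1 where 1: "\<delta>1 > 0" "\<And>d T. \<lbrakk>d division_of T; T \<subseteq> S; (\<Sum>K\<in>d. Sup K - Inf K) < \<delta>1\<rbrakk>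
            \<Longrightarrow> (\<Sum>K\<in>d. norm (f (Sup K) - f (Inf K))) < e / (2 * C)"
    using f e unfolding abs_continuous_on_def by metis
  obtain \<delta>2 where 2: "\<delta>2 > 0" "\<And>d T. \<lbrakk>d division_of T; T \<subseteq> S; (\<Sum>K\<in>d. Sup K - Inf K) < \<delta>2\<rbrakk>
            \<Longrightarrow> (\<Sum>K\<in>d. norm (g (Sup K) - g (Inf K))) < e / (2 * C)"
    using g e unfolding abs_continuous_on_def by metis
  show "\<exists>\<delta>>0. \<forall>d T. d division_of T \<and> T \<subseteq> S \<and> (\<Sum>K\<in>d. Sup K - Inf K) < \<delta> \<longrightarrow>
        (\<Sum>K\<in>d. norm (h (Sup K) - h (Inf K))) < e"
  proof (intro exI[of _ "min \<delta>1 \<delta>2"] conjI allI impI)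
    show "min \<delta>1 \<delta>2 > 0" using 1 2 by simp
    fix d T
    assume d: "d division_of T \<and> T \<subseteq> S \<and> (\<Sum>K\<in>d. Sup K - Inf K) < min \<delta>1 \<delta>2"
    have "(\<Sum>K\<in>d. norm (h (Sup K) - h (Inf K)))
        \<le> (\<Sum>K\<in>d. C * (norm (f (Sup K) - f (Inf K)) + norm (g (Sup K) - g (Inf K))))"
    proof (intro sum_mono le)
      fix K assume K: "K \<in> d"
      have dT: "d division_of T" using d by simp
      obtain u v where "K = cbox u v" "K \<noteq> {}" "K \<subseteq> T"
        using division_ofD(2-4)[OF dT K] by blast
      then show "Sup K \<in> S" "Inf K \<in> S" using d by auto
    qed
    also have "\<dots> = C * ((\<Sum>K\<in>d. norm (f (Sup K) - f (Inf K))) + (\<Sum>K\<in>d. norm (g (Sup K) - g (Inf K))))"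
      by (simp add: sum_distrib_left sum.distrib distrib_left)
    also have "\<dots> < C * (e / (2 * C) + e / (2 * C))"
      using 1(2)[of d T] 2(2)[of d T] d C by (intro mult_strict_left_mono add_strict_mono) auto
    also have "\<dots> = e" using C by simp
    finally show "(\<Sum>K\<in>d. norm (h (Sup K) - h (Inf K))) < e" .
  qed
qed

lemma abs_continuous_on_add:
  assumes "abs_continuous_on S f" "abs_continuous_on S g"
  shows "abs_continuous_on S (\<lambda>x. f x + g x)"
  using assms
  by (rule abs_continuous_on_dominated[where C = 1]) (auto simp: add_diff_add intro: norm_triangle_ineq)

text \<open>Both factors are continuous on a compact interval, hence bounded, so the usual splitting
  of a difference of products bounds its increments by those of the factors.\<close>

lemma abs_continuous_on_mult:
  fixes f g :: "real \<Rightarrow> 'a::real_normed_algebra"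
  assumes f: "abs_continuous_on {a..b} f" and g: "abs_continuous_on {a..b} g"
  shows "abs_continuous_on {a..b} (\<lambda>x. f x * g x)"
proof -
  have "bounded (f ` {a..b})" "bounded (g ` {a..b})"
    using f g by (auto intro!: compact_imp_bounded compact_continuous_image abs_continuous_on_imp_continuous_on)
  then obtain A B where A: "A > 0" "\<And>x. x \<in> {a..b} \<Longrightarrow> norm (f x) \<le> A"
    and B: "B > 0" "\<And>x. x \<in> {a..b} \<Longrightarrow> norm (g x) \<le> B"
    unfolding bounded_pos by auto
  show ?thesis
  proof (rule abs_continuous_on_dominated[OF f g, of _ "max A B"])
    fix x y assume xy: "x \<in> {a..b}" "y \<in> {a..b}"
    have "f x * g x - f y * g y = (f x - f y) * g x + f y * (g x - g y)" by (simp add: algebra_simps)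
    also have "norm \<dots> \<le> norm (f x - f y) * norm (g x) + norm (f y) * norm (g x - g y)"
      by (intro norm_triangle_mono norm_mult_ineq)
    also have "\<dots> \<le> norm (f x - f y) * max A B + max A B * norm (g x - g y)"
      using A(2)[OF xy(2)] B(2)[OF xy(1)] by (intro add_mono mult_left_mono mult_right_mono) auto
    finally show "norm (f x * g x - f y * g y) \<le> max A B * (norm (f x - f y) + norm (g x - g y))"
      by (simp add: algebra_simps)
  qed (use A B in auto)
qed

lemma abs_continuous_on_cnj:
  assumes "abs_continuous_on S f"
  shows "abs_continuous_on S (\<lambda>x. cnj (f x))"
  using assms assms
  by (rule abs_continuous_on_dominated[where C = 1]) (auto simp flip: complex_cnj_diff)

lemma abs_continuous_on_cmult:
  fixes c :: "'a::real_normed_algebra"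
  assumes "abs_continuous_on S f"
  shows "abs_continuous_on S (\<lambda>x. c * f x)"
  using assms assms
\<comment> \<open>Adding 1 keeps the constant positive when \<open>c = 0\<close>.\<close>
proof (rule abs_continuous_on_dominated[where C = "norm c + 1"])
  fix x y
  have "norm (c * f x - c * f y) \<le> norm c * norm (f x - f y)"
    by (metis norm_mult_ineq right_diff_distrib)
  also have "\<dots> \<le> (norm c + 1) * (norm (f x - f y) + norm (f x - f y))"
    by (intro mult_mono) auto
  finally show "norm (c * f x - c * f y) \<le> (norm c + 1) * (norm (f x - f y) + norm (f x - f y))" .
qed (simp add: add_nonneg_pos)

text \<open>The continuous nonnegative function \<open>norm (f x - c)\<close> has integral 0, so it
  vanishes everywhere. This upgrades almost-everywhere conclusions about \<open>v\<close>,
  \<open>N\<close> and \<open>g\<close> to pointwise ones.\<close>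

lemma continuous_eq_if_negligible:
  fixes f :: "real \<Rightarrow> 'a::real_normed_vector"
  assumes "a < b" and f: "continuous_on {a..b} f" and neg: "negligible {x \<in> {a..b}. f x \<noteq> c}"
    and x: "x \<in> {a..b}"
  shows "f x = c"
proof -
  have "((\<lambda>x. norm (f x - c)) has_integral 0) {a..b}"
    by (rule has_integral_spike[OF neg, of _ _ "\<lambda>_. 0"]) auto
  then have "norm (f x - c) = 0"
    using assms by (intro has_integral_0_cbox_imp_0[of a b "\<lambda>x. norm (f x - c)"] continuous_intros) auto
  then show ?thesis by simp
qed

text \<open>On the compact interval \<open>f\<close> is bounded and measurable, which suffices
  against an integrable \<open>g\<close>. Scalar multiplication covers both the real integrands of
  the energies and the complex ones of the equation.\<close>

lemma absolutely_integrable_continuous_mult: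
  fixes g :: "real \<Rightarrow> real" and f :: "real \<Rightarrow> 'a::euclidean_space"
  assumes g: "g absolutely_integrable_on {a..b}" and f: "continuous_on {a..b} f"
  shows "(\<lambda>x. g x *\<^sub>R f x) absolutely_integrable_on {a..b}"
proof (rule absolutely_integrable_bounded_measurable_product[where h = "\<lambda>x y. y *\<^sub>R x", OF _ _ _ _ g])
  show "bilinear (\<lambda>x y. y *\<^sub>R (x::'a))"
    by (auto simp: bilinear_def linear_iff algebra_simps)
  show "f \<in> borel_measurable (lebesgue_on {a..b})"
    by (rule continuous_imp_measurable_on_sets_lebesgue[OF f]) auto
  show "bounded (f ` {a..b})"
    by (intro compact_imp_bounded compact_continuous_image f) auto
qed auto

lemma integrable_continuous_mult:
  fixes g :: "real \<Rightarrow> real" and f :: "real \<Rightarrow> 'a::euclidean_space"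
  assumes "g absolutely_integrable_on {a..b}" "continuous_on {a..b} f" "a \<le> x" "y \<le> b"
  shows "(\<lambda>x. g x *\<^sub>R f x) integrable_on {x..y}"
  using absolutely_integrable_continuous_mult[OF assms(1,2)] assms(3,4)
  by (auto intro: integrable_subinterval_real dest: set_lebesgue_integral_eq_integral(1))

subsection \<open>Compactness of Floquet solutions\<close>

text \<open>The weight equal to \<open>(norm \<rho>)\<^sup>2\<close> on \<open>{0..x}\<close> and to \<open>1\<close> on \<open>{x..a}\<close> cancels the boundary terms of the
  energy identity at both end points of the period. What remains is a term at \<open>x\<close>, which is small
  relative to the energy when \<open>x\<close> minimises \<open>norm (v x)\<close>.\<close>

lemma energy_bound:
  fixes a \<tau> :: real and r q w :: "real \<Rightarrow> real" and u v :: "real \<Rightarrow> complex" and \<rho> :: complex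
  defines "P \<equiv> integral {0..a} r" and "Q \<equiv> integral {0..a} (\<lambda>t. \<bar>q t\<bar>)"
    and "m \<equiv> min 1 ((norm \<rho>)\<^sup>2)" and "K \<equiv> 1 + (norm \<rho>)\<^sup>2"
  assumes a: "a > 0" and r: "r absolutely_integrable_on {0..a}" "\<And>t. t \<in> {0..a} \<Longrightarrow> r t \<ge> 0"
    and P: "P > 0" and q: "q absolutely_integrable_on {0..a}"
    and u: "continuous_on {0..a} u" and v: "continuous_on {0..a} v"
    and energy: "\<And>x y. 0 \<le> x \<Longrightarrow> x \<le> y \<Longrightarrow> y \<le> a \<Longrightarrow>
      ((\<lambda>t. of_real (r t * (norm (v t))\<^sup>2) + (of_real (q t) - \<i> * of_real \<tau> * of_real (w t)) * of_real ((norm (u t))\<^sup>2))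
         has_integral (v y * cnj (u y) - v x * cnj (u x))) {x..y}"
    and \<rho>: "\<rho> \<noteq> 0" "u a = \<rho> * u 0" "v a = \<rho> * v 0"
    and u1: "\<And>t. t \<in> {0..a} \<Longrightarrow> norm (u t) \<le> 1"
  defines "E \<equiv> integral {0..a} (\<lambda>t. r t * (norm (v t))\<^sup>2)"
  shows "E \<le> 2 * (K * Q + K\<^sup>2 / (2 * m * P)) / m"
    and "\<exists>x\<in>{0..a}. (norm (v x))\<^sup>2 * P \<le> E"
proof -
  \<comment> \<open>\<open>m\<close> bounds the two values of the weight from below;
    \<open>K\<close> bounds them from above and also bounds the jump of the weight at
    \<open>x\<close>.\<close>
  have m: "m > 0" "m \<le> 1" "m \<le> (norm \<rho>)\<^sup>2" using \<rho>(1) by (auto simp: m_def)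
  have K: "K \<ge> 1" "(norm \<rho>)\<^sup>2 \<le> K" "\<bar>(norm \<rho>)\<^sup>2 - 1\<bar> \<le> K"
    by (auto simp: K_def abs_le_iff)
  obtain x where x: "x \<in> {0..a}" and min: "\<And>t. t \<in> {0..a} \<Longrightarrow> norm (v x) \<le> norm (v t)"
    using continuous_attains_inf[of "{0..a}" "\<lambda>t. norm (v t)"] continuous_on_norm[OF v] a
    by (metis compact_Icc atLeastatMost_empty_iff2 less_imp_le not_le)
  define s where "s = norm (v x)"
  have iv: "(\<lambda>t. r t * (norm (v t))\<^sup>2) integrable_on {c..d}" if "0 \<le> c" "d \<le> a" for c d
    using integrable_continuous_mult[OF r(1), of "\<lambda>t. (norm (v t))\<^sup>2" c d] that
    by (simp add: continuous_intros v)
  have iq: "(\<lambda>t. q t * (norm (u t))\<^sup>2) integrable_on {c..d}" if "0 \<le> c" "d \<le> a" for c d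
    using integrable_continuous_mult[OF q(1), of "\<lambda>t. (norm (u t))\<^sup>2" c d] that
    by (simp add: continuous_intros u)
  have ir: "r integrable_on {0..a}" and iaq0: "(\<lambda>t. \<bar>q t\<bar>) integrable_on {0..a}"
    using r q by (simp_all add: absolutely_integrable_on_def)
  have iaq: "(\<lambda>t. \<bar>q t\<bar>) integrable_on {c..d}" if "0 \<le> c" "d \<le> a" for c d
    using integrable_subinterval_real[OF iaq0] that by auto
  have sP: "s\<^sup>2 * P \<le> E"
  proof -
    have "s\<^sup>2 * P = integral {0..a} (\<lambda>t. s\<^sup>2 * r t)" by (simp add: P_def)
    also have "\<dots> \<le> E" unfolding E_def
    proof (intro integral_le)
      show "(\<lambda>t. s\<^sup>2 * r t) integrable_on {0..a}" using ir by (rule integrable_on_mult_right)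
      fix t assume "t \<in> {0..a}"
      then show "s\<^sup>2 * r t \<le> r t * (norm (v t))\<^sup>2"
        using min r(2) by (subst mult.commute) (auto simp: s_def intro!: mult_left_mono power_mono)
    qed (use iv in auto)
    finally show ?thesis .
  qed
  then show "\<exists>x\<in>{0..a}. (norm (v x))\<^sup>2 * P \<le> E" using x s_def by blast
  define e q' where "e = (\<lambda>c d. integral {c..d} (\<lambda>t. r t * (norm (v t))\<^sup>2))"
    and "q' = (\<lambda>c d. integral {c..d} (\<lambda>t. q t * (norm (u t))\<^sup>2))"
  have re: "e c d + q' c d = Re (v d * cnj (u d) - v c * cnj (u c))" if "0 \<le> c" "c \<le> d" "d \<le> a" for c d
  proof -
    have "((\<lambda>t. Re (of_real (r t * (norm (v t))\<^sup>2) + (of_real (q t) - \<i> * of_real \<tau> * of_real (w t)) * of_real ((norm (u t))\<^sup>2)))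
         has_integral Re (v d * cnj (u d) - v c * cnj (u c))) {c..d}"
      by (rule has_integral_Re[OF energy[OF that]])
    then have "((\<lambda>t. r t * (norm (v t))\<^sup>2 + q t * (norm (u t))\<^sup>2)
         has_integral Re (v d * cnj (u d) - v c * cnj (u c))) {c..d}"
      by simp
    moreover have "((\<lambda>t. r t * (norm (v t))\<^sup>2 + q t * (norm (u t))\<^sup>2) has_integral (e c d + q' c d)) {c..d}"
      unfolding e_def q'_def using iv iq that by (intro has_integral_add integrable_integral) auto
    ultimately show ?thesis by (rule has_integral_unique[rotated])
  qed
  have eE: "e 0 x + e x a = E"
    unfolding e_def E_def using x iv by (intro Henstock_Kurzweil_Integration.integral_combine) auto
  have e0: "e c d \<ge> 0" if "0 \<le> c" "d \<le> a" for c d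
    unfolding e_def using iv r(2) that by (intro integral_nonneg) auto
  define aq where "aq = (\<lambda>c d. integral {c..d} (\<lambda>t. \<bar>q t\<bar>))"
  have aqQ: "aq 0 x + aq x a = Q"
    unfolding aq_def Q_def using x iaq by (intro Henstock_Kurzweil_Integration.integral_combine) auto
  have qq: "\<bar>q' c d\<bar> \<le> aq c d" if "0 \<le> c" "d \<le> a" for c d
  proof -
    have "norm (q' c d) \<le> aq c d"
      unfolding q'_def aq_def
    proof (intro integral_norm_bound_integral)
      fix t assume "t \<in> {c..d}"
      then have "(norm (u t))\<^sup>2 \<le> 1" using u1[of t] that by (auto simp: power_le_one)
      then show "norm (q t * (norm (u t))\<^sup>2) \<le> \<bar>q t\<bar>" by (simp add: abs_mult mult_left_le)
    qed (use iq iaq that in auto)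
    then show ?thesis by simp
  qed
  define z where "z = Re (v x * cnj (u x))"
  have z: "\<bar>z\<bar> \<le> s"
  proof -
    have "\<bar>z\<bar> \<le> norm (v x * cnj (u x))" unfolding z_def by (rule abs_Re_le_cmod)
    also have "\<dots> \<le> s" using u1[OF x] by (simp add: norm_mult s_def mult_left_le)
    finally show ?thesis .
  qed
  have va: "Re (v a * cnj (u a)) = (norm \<rho>)\<^sup>2 * Re (v 0 * cnj (u 0))"
  proof -
    have "v a * cnj (u a) = (\<rho> * cnj \<rho>) * (v 0 * cnj (u 0))" by (simp add: \<rho>)
    also have "\<rho> * cnj \<rho> = of_real ((norm \<rho>)\<^sup>2)" by (rule complex_norm_square[symmetric])
    finally show ?thesis by simp
  qed
  \<comment> \<open>By \<open>va\<close>, the boundary term at \<open>a\<close> is exactly the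
    weighted one at 0, so only the jump of the weight times \<open>z\<close> survives.\<close>
  have "(norm \<rho>)\<^sup>2 * (e 0 x + q' 0 x) + (e x a + q' x a) = ((norm \<rho>)\<^sup>2 - 1) * z"
  proof -
    have "e 0 x + q' 0 x = z - Re (v 0 * cnj (u 0))"
      and "e x a + q' x a = Re (v a * cnj (u a)) - z"
      using re[of 0 x] re[of x a] x by (simp_all add: z_def)
    then show ?thesis
      by (simp only: va right_diff_distrib left_diff_distrib)
  qed
  moreover have "((norm \<rho>)\<^sup>2 - 1) * z \<le> K * s"
  proof -
    have "((norm \<rho>)\<^sup>2 - 1) * z \<le> \<bar>(norm \<rho>)\<^sup>2 - 1\<bar> * \<bar>z\<bar>" by (metis abs_ge_self abs_mult)
    also have "\<dots> \<le> K * s" using K z by (intro mult_mono) auto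
    finally show ?thesis .
  qed
  moreover have "- (K * aq 0 x) \<le> (norm \<rho>)\<^sup>2 * q' 0 x" 
  proof -
    have "(norm \<rho>)\<^sup>2 * - q' 0 x \<le> (norm \<rho>)\<^sup>2 * aq 0 x"
      using qq[of 0 x] x by (intro mult_left_mono) auto
    also have "\<dots> \<le> K * aq 0 x" using K qq[of 0 x] x by (intro mult_right_mono) auto
    finally show ?thesis by simp
  qed
  moreover have "- (K * aq x a) \<le> q' x a"
  proof -
    have "1 * aq x a \<le> K * aq x a" using K qq[of x a] x by (intro mult_right_mono) auto
    then show ?thesis using qq[of x a] x by auto
  qed
  moreover have "m * e 0 x \<le> (norm \<rho>)\<^sup>2 * e 0 x" "m * e x a \<le> 1 * e x a"
    using m x by (intro mult_right_mono e0; simp)+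
  moreover have "m * E = m * e 0 x + m * e x a" "K * Q = K * aq 0 x + K * aq x a"
    by (simp_all add: eE[symmetric] aqQ[symmetric] algebra_simps)
  ultimately have "m * E \<le> K * s + K * Q"
    by (simp add: algebra_simps)
  \<comment> \<open>Young's inequality, by completing a square in \<open>s\<close>. The parameter
    \<open>m * P\<close> is chosen so that \<open>sP\<close> turns the quadratic term into half of
    \<open>m * E\<close>, which is absorbed on the left; hence the factor 2 in the bound.\<close>
  moreover have "K * s \<le> m * E / 2 + K\<^sup>2 / (2 * m * P)"
  proof -
    have "0 \<le> (m * P * s - K)\<^sup>2 / (2 * m * P)" using m P by simp
    also have "\<dots> = m * (s\<^sup>2 * P) / 2 + K\<^sup>2 / (2 * m * P) - K * s"
      using m P by (simp add: field_simps power2_eq_square)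
    finally have "K * s \<le> m * (s\<^sup>2 * P) / 2 + K\<^sup>2 / (2 * m * P)" by simp
    moreover have "m * (s\<^sup>2 * P) \<le> m * E" using sP m by (intro mult_left_mono) auto
    ultimately show ?thesis by simp
  qed
  ultimately have "m * E \<le> 2 * (K * Q + K\<^sup>2 / (2 * m * P))" by argo
  then show "E \<le> 2 * (K * Q + K\<^sup>2 / (2 * m * P)) / m"
    using m by (simp add: pos_le_divide_eq mult.commute)
qed

text \<open>The compactness argument, with \<open>r\<close> for \<open>1 / p\<close> and
  \<open>\<tau> = n + 1\<close>. The equation appears only through its integrated forms, so
  exceptional sets of the derivatives no longer matter. All hypotheses refer to a single
  \<open>\<rho>\<close>.\<close>

lemma no_floquet_sequence:
  fixes a :: real and r q w :: "real \<Rightarrow> real" and u v :: "nat \<Rightarrow> real \<Rightarrow> complex" and \<rho> :: complex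
  assumes a: "a > 0" and r: "r absolutely_integrable_on {0..a}" "\<And>t. t \<in> {0..a} \<Longrightarrow> r t \<ge> 0"
    and r0: "negligible {t \<in> {0..a}. r t = 0}"
    and q: "q absolutely_integrable_on {0..a}"
    and w: "w absolutely_integrable_on {0..a}" and w0: "negligible {t \<in> {0..a}. w t = 0}"
    and u: "\<And>n. continuous_on {0..a} (u n)" and v: "\<And>n. continuous_on {0..a} (v n)"
    and du: "\<And>n x y. 0 \<le> x \<Longrightarrow> x \<le> y \<Longrightarrow> y \<le> a \<Longrightarrow>
      ((\<lambda>t. of_real (r t) * v n t) has_integral (u n y - u n x)) {x..y}"
    and dv: "\<And>n x y. 0 \<le> x \<Longrightarrow> x \<le> y \<Longrightarrow> y \<le> a \<Longrightarrow>
      ((\<lambda>t. (of_real (q t) - \<i> * of_real (real (Suc n)) * of_real (w t)) * u n t) has_integral (v n y - v n x)) {x..y}"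
    and energy: "\<And>n x y. 0 \<le> x \<Longrightarrow> x \<le> y \<Longrightarrow> y \<le> a \<Longrightarrow>
      ((\<lambda>t. of_real (r t * (norm (v n t))\<^sup>2) +
            (of_real (q t) - \<i> * of_real (real (Suc n)) * of_real (w t)) * of_real ((norm (u n t))\<^sup>2))
         has_integral (v n y * cnj (u n y) - v n x * cnj (u n x))) {x..y}"
    and \<rho>: "\<rho> \<noteq> 0" "\<And>n. u n a = \<rho> * u n 0" "\<And>n. v n a = \<rho> * v n 0"
    and u1: "\<And>n t. t \<in> {0..a} \<Longrightarrow> norm (u n t) \<le> 1"
    and umax: "\<And>n. \<exists>t\<in>{0..a}. norm (u n t) = 1"
  shows False
proof -
  have ir: "r integrable_on {0..a}"
    using r(1) by (auto dest: set_lebesgue_integral_eq_integral(1))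
  define P Q W where "P = integral {0..a} r" and "Q = integral {0..a} (\<lambda>t. \<bar>q t\<bar>)"
    and "W = integral {0..a} (\<lambda>t. \<bar>w t\<bar>)"
  have P: "P > 0"
  proof (rule ccontr)
    assume "\<not> P > 0"
    then have "(r has_integral 0) {0..a}"
      using ir r(2) integral_nonneg[OF ir] unfolding P_def by (metis antisym_conv2 integrable_integral)
    then have "negligible {t \<in> {0..a}. r t \<noteq> 0}"
      by (rule has_integral_zero_imp_negligible) (use r in auto)
    then have "negligible ({t \<in> {0..a}. r t \<noteq> 0} \<union> {t \<in> {0..a}. r t = 0})"
      using r0 by (rule negligible_Un)
    also have "{t \<in> {0..a}. r t \<noteq> 0} \<union> {t \<in> {0..a}. r t = 0} = cbox 0 a" by auto
    finally show False using a negligible_interval(1)[of 0 a] by simp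
  qed
  define E where "E = (\<lambda>n. integral {0..a} (\<lambda>t. r t * (norm (v n t))\<^sup>2))"
  \<comment> \<open>The bound of \<open>energy_bound\<close> involves \<open>P\<close>,
    \<open>Q\<close> and \<open>\<rho>\<close> but not \<open>\<tau>\<close>, so it serves for all
    \<open>n\<close>.\<close>
  obtain C where C: "\<And>n. E n \<le> C" and minv: "\<And>n. \<exists>x\<in>{0..a}. (norm (v n x))\<^sup>2 * P \<le> E n"
    using energy_bound[OF a r P[unfolded P_def] q u v energy \<rho>(1,2,3) u1]
    unfolding E_def P_def by blast
  have iv: "(\<lambda>t. r t * (norm (v n t))\<^sup>2) integrable_on {c..d}" if "0 \<le> c" "d \<le> a" for c d n
    using integrable_continuous_mult[OF r(1), of "\<lambda>t. (norm (v n t))\<^sup>2" c d] that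
    by (simp add: continuous_intros v)
  have ivn: "(\<lambda>t. r t * norm (v n t)) integrable_on {c..d}" if "0 \<le> c" "d \<le> a" for c d n
    using integrable_continuous_mult[OF r(1), of "\<lambda>t. norm (v n t)" c d] that
    by (simp add: continuous_intros v)
  have E0: "E n \<ge> 0" for n unfolding E_def using iv r(2) by (intro integral_nonneg) auto
  have C0: "C \<ge> 0" using C[of 0] E0[of 0] by linarith
  have irs: "r integrable_on {c..d}" if "0 \<le> c" "d \<le> a" for c d
    using integrable_subinterval_real[OF ir] that by auto
  define R where "R = (\<lambda>y. integral {0..y} r)"
  have contR: "continuous_on {0..a} R" unfolding R_def by (rule indefinite_integral_continuous_1[OF ir])
  have R_diff: "R y - R x = integral {x..y} r" if "0 \<le> x" "x \<le> y" "y \<le> a" for x y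
    using Henstock_Kurzweil_Integration.integral_combine[of 0 x y r] irs[of 0 y] that by (auto simp: R_def)

  \<comment> \<open>Young's inequality in place of Cauchy-Schwarz: \<open>r * |v|\<close> is at most
    the mean of \<open>\<eta> * r\<close> and \<open>r * |v|^2 / \<eta>\<close>. A large
    \<open>\<eta>\<close> makes the energy part small, and then continuity of \<open>R\<close> takes
    care of the other part.\<close>
  have equi: "norm (u n x - u n y) \<le> (\<eta> * \<bar>R y - R x\<bar> + C / \<eta>) / 2"
    if "x \<in> {0..a}" "y \<in> {0..a}" "\<eta> > 0" for n x y \<eta>
  proof -
    have *: "norm (u n y - u n x) \<le> (\<eta> * (R y - R x) + C / \<eta>) / 2"
      if "0 \<le> x" "x \<le> y" "y \<le> a" for x y
    proof -
      have "norm (u n y - u n x) \<le> integral {x..y} (\<lambda>t. r t * norm (v n t))"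
        unfolding integral_unique[OF du[OF that, of n], symmetric]
        using du[OF that, of n] ivn that r(2)
        by (intro integral_norm_bound_integral) (auto simp: norm_mult)
      also have "\<dots> \<le> integral {x..y} (\<lambda>t. \<eta> / 2 * r t + 1 / (2 * \<eta>) * (r t * (norm (v n t))\<^sup>2))"
      proof (intro integral_le)
        fix t assume t: "t \<in> {x..y}"
        have "0 \<le> r t * ((\<eta> - norm (v n t))\<^sup>2 / (2 * \<eta>))"
          using r(2)[of t] t that \<open>\<eta> > 0\<close> by auto
        also have "\<dots> = \<eta> / 2 * r t + 1 / (2 * \<eta>) * (r t * (norm (v n t))\<^sup>2) - r t * norm (v n t)"
          using \<open>\<eta> > 0\<close> by (simp add: field_simps power2_eq_square)
        finally show "r t * norm (v n t) \<le> \<eta> / 2 * r t + 1 / (2 * \<eta>) * (r t * (norm (v n t))\<^sup>2)" by simp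
      next
        show "(\<lambda>t. \<eta> / 2 * r t + 1 / (2 * \<eta>) * (r t * (norm (v n t))\<^sup>2)) integrable_on {x..y}"
          using irs iv that by (intro integrable_add integrable_on_mult_right) auto
      qed (use ivn that in auto)
      also have "\<dots> = \<eta> / 2 * (R y - R x) + 1 / (2 * \<eta>) * integral {x..y} (\<lambda>t. r t * (norm (v n t))\<^sup>2)"
        using irs iv that
        by (subst integral_add) (auto simp del: times_divide_eq_left simp: R_diff intro!: integrable_on_mult_right)
      also have "integral {x..y} (\<lambda>t. r t * (norm (v n t))\<^sup>2) \<le> E n"
        unfolding E_def using iv that r(2) by (intro integral_subset_le) auto
      also have "E n \<le> C" by (rule C)
      finally show ?thesis using \<open>\<eta> > 0\<close> by (simp add: field_simps)
    qed
    have R_mono: "R x \<le> R y" if "0 \<le> x" "x \<le> y" "y \<le> a" for x y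
    proof -
      have "0 \<le> integral {x..y} r" using irs r(2) that by (intro integral_nonneg) auto
      then show ?thesis using R_diff[OF that] by simp
    qed
    show ?thesis
      using *[of x y] *[of y x] R_mono[of x y] R_mono[of y x] that
      by (cases "x \<le> y") (auto simp: norm_minus_commute)
  qed
  obtain g and k :: "nat \<Rightarrow> nat" where g: "continuous_on {0..a} g" and k: "strict_mono k"
    and lim: "\<And>e. 0 < e \<Longrightarrow> \<exists>N. \<forall>n x. n \<ge> N \<and> x \<in> {0..a} \<longrightarrow> norm (u (k n) x - g x) < e"
  proof (rule Arzela_Ascoli[of "{0..a}" u 1])
    fix x e :: real
    assume x: "x \<in> {0..a}" and e: "0 < e"
    \<comment> \<open>This makes \<open>C / \<eta> < e\<close>; using \<open>C + 1\<close> keeps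
      \<open>\<eta>\<close> positive when \<open>C = 0\<close>. Both terms of the mean in
      \<open>equi\<close> then stay below \<open>e\<close>.\<close>
    define \<eta> where "\<eta> = (C + 1) / e"
    have \<eta>: "\<eta> > 0" "C / \<eta> < e" using e C0 by (auto simp: \<eta>_def field_simps)
    obtain d where d: "d > 0" "\<And>y. y \<in> {0..a} \<Longrightarrow> dist y x < d \<Longrightarrow> dist (R y) (R x) < e / \<eta>"
      using contR[unfolded continuous_on_iff, rule_format, OF x, of "e / \<eta>"] e \<eta>(1)
      by (metis divide_pos_pos)
    show "\<exists>d>0. \<forall>n y. y \<in> {0..a} \<and> norm (x - y) < d \<longrightarrow> norm (u n x - u n y) < e"
    proof (intro exI[of _ d] conjI allI impI d(1))
      fix n y assume y: "y \<in> {0..a} \<and> norm (x - y) < d"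
      then have "\<bar>R y - R x\<bar> < e / \<eta>" using d(2)[of y] by (auto simp: dist_real_def)
      then have "\<eta> * \<bar>R y - R x\<bar> < e" using \<eta>(1) by (simp add: field_simps)
      then show "norm (u n x - u n y) < e" using equi[OF x conjunct1[OF y] \<eta>(1), of n] \<eta>(2) by argo
    qed
  qed (use u1 in auto)
  have iw: "(\<lambda>t. of_real (w t) * f t) integrable_on {c..d}" 
    if "continuous_on {0..a} f" "0 \<le> c" "d \<le> a" for c d and f :: "real \<Rightarrow> complex"
    using integrable_continuous_mult[OF w that] by (simp add: scaleR_conv_of_real)
  have iq: "(\<lambda>t. of_real (q t) * f t) integrable_on {c..d}" 
    if "continuous_on {0..a} f" "0 \<le> c" "d \<le> a" for c d and f :: "real \<Rightarrow> complex"
    using integrable_continuous_mult[OF q that] by (simp add: scaleR_conv_of_real)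
  have "(\<lambda>t. \<bar>q t\<bar>) integrable_on {0..a}" "(\<lambda>t. \<bar>w t\<bar>) integrable_on {0..a}"
    using q w by (simp_all add: absolutely_integrable_on_def)
  then have iaq: "(\<lambda>t. \<bar>q t\<bar>) integrable_on {c..d}" and iaw: "(\<lambda>t. \<bar>w t\<bar>) integrable_on {c..d}"
    if "0 \<le> c" "d \<le> a" for c d
    using that by (auto intro: integrable_subinterval_real)
  define I where "I = (\<lambda>f::real \<Rightarrow> complex. \<lambda>y. integral {0..y} (\<lambda>t. of_real (w t) * f t))"
  have contI: "continuous_on {0..a} (I f)" if "continuous_on {0..a} f" for f
    unfolding I_def by (rule indefinite_integral_continuous_1) (use iw that in auto)
  have I_diff: "I f y - I f x = integral {x..y} (\<lambda>t. of_real (w t) * f t)"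
    if "continuous_on {0..a} f" "0 \<le> x" "x \<le> y" "y \<le> a" for f x y
    using Henstock_Kurzweil_Integration.integral_combine[of 0 x y "\<lambda>t. of_real (w t) * f t"] iw[of f 0 y] that
    by (auto simp: I_def algebra_simps)
  have I_close: "norm (I f y - I h y) \<le> e * W"
    if f: "continuous_on {0..a} f" and h: "continuous_on {0..a} h"
      and le: "\<And>t. t \<in> {0..a} \<Longrightarrow> norm (f t - h t) \<le> e" and y: "y \<in> {0..a}" for f h e y
  proof -
    have e: "e \<ge> 0" using le[OF y] norm_ge_zero order_trans by blast
    have "I f y - I h y = integral {0..y} (\<lambda>t. of_real (w t) * f t - of_real (w t) * h t)"
      unfolding I_def using iw[OF f] iw[OF h] y by (subst integral_diff) auto
    also have "norm \<dots> \<le> integral {0..y} (\<lambda>t. e * \<bar>w t\<bar>)"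
    proof (intro integral_norm_bound_integral)
      fix t assume "t \<in> {0..y}"
      then have "\<bar>w t\<bar> * norm (f t - h t) \<le> \<bar>w t\<bar> * e"
        using le[of t] y by (intro mult_left_mono) auto
      then show "norm (of_real (w t) * f t - of_real (w t) * h t) \<le> e * \<bar>w t\<bar>"
        by (simp add: norm_mult mult.commute[of e] flip: right_diff_distrib)
    qed (use iw[OF f] iw[OF h] iaw y in \<open>auto intro!: integrable_diff integrable_on_mult_right\<close>)
    also have "\<dots> = e * integral {0..y} (\<lambda>t. \<bar>w t\<bar>)" by simp
    also have "\<dots> \<le> e * W"
      unfolding W_def using e y iaw by (intro mult_left_mono integral_subset_le) auto
    finally show ?thesis .
  qed
  have W0: "W \<ge> 0" unfolding W_def using iaw by (intro integral_nonneg) auto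
  have Q0: "Q \<ge> 0" unfolding Q_def using iaq by (intro integral_nonneg) auto
  \<comment> \<open>Integrating the equation and solving for the term with \<open>w\<close> leaves
    the values of \<open>v\<close> at both end points on the right. These have no bound uniform in
    \<open>n\<close>.\<close>
  have I_osc: "real (Suc n) * norm (I (u n) y - I (u n) x) \<le> Q + norm (v n y) + norm (v n x)"
    if "x \<in> {0..a}" "y \<in> {0..a}" for n x y
  proof -
    have *: "real (Suc n) * norm (I (u n) y - I (u n) x) \<le> Q + norm (v n y) + norm (v n x)"
      if "0 \<le> x" "x \<le> y" "y \<le> a" for x y
    proof -
      have "((\<lambda>t. of_real (q t) * u n t - \<i> * of_real (real (Suc n)) * (of_real (w t) * u n t)) has_integral
          (integral {x..y} (\<lambda>t. of_real (q t) * u n t) - \<i> * of_real (real (Suc n)) * (I (u n) y - I (u n) x))) {x..y}"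
        using iq[OF u] iw[OF u] that
        by (intro has_integral_diff has_integral_mult_right) (auto simp: I_diff[OF u] integrable_integral simp del: of_real_of_nat_eq)
      moreover have "((\<lambda>t. of_real (q t) * u n t - \<i> * of_real (real (Suc n)) * (of_real (w t) * u n t)) has_integral
          (v n y - v n x)) {x..y}"
        using dv[OF that, of n] by (simp add: algebra_simps)
      ultimately have "integral {x..y} (\<lambda>t. of_real (q t) * u n t) - \<i> * of_real (real (Suc n)) * (I (u n) y - I (u n) x) = v n y - v n x"
        by (rule has_integral_unique)
      then have eq: "\<i> * of_real (real (Suc n)) * (I (u n) y - I (u n) x) = integral {x..y} (\<lambda>t. of_real (q t) * u n t) - v n y + v n x"
        by (simp add: algebra_simps)
      have "norm (integral {x..y} (\<lambda>t. of_real (q t) * u n t)) \<le> integral {x..y} (\<lambda>t. \<bar>q t\<bar>)"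
        using iq[OF u] iaq that u1[of _ n]
        by (intro integral_norm_bound_integral) (auto simp: norm_mult mult_left_le)
      also have "\<dots> \<le> Q" unfolding Q_def using iaq that by (intro integral_subset_le) auto
      finally have "norm (\<i> * of_real (real (Suc n)) * (I (u n) y - I (u n) x)) \<le> Q + norm (v n y) + norm (v n x)"
        unfolding eq by (smt (verit) norm_triangle_ineq norm_triangle_ineq4)
      then show ?thesis by (simp only: norm_mult norm_ii norm_of_real abs_of_nat mult_1)
    qed
    show ?thesis
      using *[of x y] *[of y x] that by (cases "x \<le> y") (auto simp: norm_minus_commute add_ac)
  qed
  define N where "N = I g"
  have contN: "continuous_on {0..a} N" unfolding N_def by (rule contI[OF g])
  \<comment> \<open>The weighted mean deviation of \<open>N\<close> from its value at
    \<open>x\<close>. Averaging over \<open>y\<close> with weight \<open>r\<close> replaces the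
    uncontrolled \<open>|v n y|\<close> by the energy; \<open>x\<close> stays free, since the point
    where \<open>|v n x|\<close> is controlled varies with \<open>n\<close>.\<close>
  define G where "G = (\<lambda>x. integral {0..a} (\<lambda>y. r y * norm (N y - N x)))"
  have iG: "(\<lambda>y. r y * norm (N y - c)) integrable_on {0..a}" for c
    using integrable_continuous_mult[OF r(1), of "\<lambda>y. norm (N y - c)" 0 a]
    by (simp add: continuous_intros contN)
  have "\<exists>x\<in>{0..a}. G x \<le> e" if e: "e > 0" for e
  proof -
    \<comment> \<open>The total coefficient of \<open>1 / (j + 1)\<close> in the estimate of
      \<open>G x\<close>. The 2 comes from applying \<open>t \<le> 1 + t^2\<close> to
      \<open>|v|\<close> at both end points, \<open>C / P\<close> bounds \<open>|v j x|^2\<close>,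
      and the last \<open>C\<close> is the averaged \<open>|v j y|^2\<close>.\<close>
    define C2 where "C2 = (Q + 2 + C / P) * P + C"
    have C2: "C2 \<ge> 0" using Q0 C0 P by (simp add: C2_def)
    \<comment> \<open>Replacing \<open>u j\<close> by its limit \<open>g\<close> at both end points
      costs \<open>2 * \<epsilon> * W * P\<close>, at most \<open>e / 2\<close>. The summand 1
      avoids treating \<open>W = 0\<close> separately.\<close>
    define \<epsilon> where "\<epsilon> = e / (4 * (W * P + 1))"
    have \<epsilon>: "\<epsilon> > 0" using e W0 P by (simp add: \<epsilon>_def add_nonneg_pos)
    have "4 * \<epsilon> * (W * P) \<le> e" 
    proof -
      have "4 * \<epsilon> * (W * P) \<le> 4 * \<epsilon> * (W * P + 1)" using \<epsilon> by (intro mult_left_mono) auto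
      also have "\<dots> = e" using add_nonneg_pos[of "W * P" 1] W0 P by (simp add: \<epsilon>_def field_simps)
      finally show ?thesis .
    qed
    obtain M where M: "\<And>n x. n \<ge> M \<Longrightarrow> x \<in> {0..a} \<Longrightarrow> norm (u (k n) x - g x) < \<epsilon>"
      using lim[OF \<epsilon>] by blast
    obtain M' where M': "real M' > 2 * C2 / e" using reals_Archimedean2 by blast
    define n where "n = max M M'"
    define j where "j = k n"
    have jn: "j \<ge> n" unfolding j_def by (rule strict_mono_imp_increasing[OF k])
    obtain x where x: "x \<in> {0..a}" and vx: "(norm (v j x))\<^sup>2 * P \<le> E j" using minv by blast
    have vx1: "norm (v j x) \<le> 1 + C / P"
    proof -
      have "(norm (v j x))\<^sup>2 \<le> C / P" using vx C[of j] P by (simp add: pos_le_divide_eq)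
      moreover have "norm (v j x) \<le> 1 + (norm (v j x))\<^sup>2"
        using zero_le_power2[of "norm (v j x) - 1 / 2"] by (simp add: power2_eq_square algebra_simps)
      ultimately show ?thesis by linarith
    qed
    have pt: "r y * norm (N y - N x) \<le>
        (2 * \<epsilon> * W + (Q + 2 + C / P) / real (Suc j)) * r y + 1 / real (Suc j) * (r y * (norm (v j y))\<^sup>2)"
      if y: "y \<in> {0..a}" for y
    proof -
      have cl: "norm (I (u j) z - N z) \<le> \<epsilon> * W" if "z \<in> {0..a}" for z
        unfolding N_def using M[of n] that
        by (intro I_close u g) (auto simp: n_def j_def less_imp_le)
      have "norm (v j y) \<le> 1 + (norm (v j y))\<^sup>2"
        using zero_le_power2[of "norm (v j y) - 1 / 2"] by (simp add: power2_eq_square algebra_simps)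
      then have "real (Suc j) * norm (I (u j) y - I (u j) x) \<le> Q + 2 + C / P + (norm (v j y))\<^sup>2"
        using I_osc[OF x y, of j] vx1 by linarith
      then have "norm (I (u j) y - I (u j) x) \<le> (Q + 2 + C / P + (norm (v j y))\<^sup>2) / real (Suc j)"
        by (simp add: pos_le_divide_eq mult.commute del: of_nat_Suc)
      moreover have "norm (N y - N x) \<le> norm (I (u j) y - N y) + norm (I (u j) x - N x) + norm (I (u j) y - I (u j) x)"
      proof -
        have "N y - N x = (I (u j) y - I (u j) x) - (I (u j) y - N y) + (I (u j) x - N x)" by simp
        then show ?thesis by (smt (verit) norm_triangle_ineq norm_triangle_ineq4)
      qed
      ultimately have "norm (N y - N x) \<le> 2 * \<epsilon> * W + (Q + 2 + C / P + (norm (v j y))\<^sup>2) / real (Suc j)"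
        using cl[OF x] cl[OF y] by linarith
      then have "r y * norm (N y - N x) \<le> r y * (2 * \<epsilon> * W + (Q + 2 + C / P + (norm (v j y))\<^sup>2) / real (Suc j))"
        using r(2)[OF y] by (rule mult_left_mono)
      also have "\<dots> = (2 * \<epsilon> * W + (Q + 2 + C / P) / real (Suc j)) * r y + 1 / real (Suc j) * (r y * (norm (v j y))\<^sup>2)"
        by (simp add: add_divide_distrib algebra_simps del: of_nat_Suc)
      finally show ?thesis .
    qed
    have "((\<lambda>y. (2 * \<epsilon> * W + (Q + 2 + C / P) / real (Suc j)) * r y + 1 / real (Suc j) * (r y * (norm (v j y))\<^sup>2))
        has_integral ((2 * \<epsilon> * W + (Q + 2 + C / P) / real (Suc j)) * P + 1 / real (Suc j) * E j)) {0..a}"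
      unfolding P_def E_def using ir iv
      by (intro has_integral_add has_integral_mult_right integrable_integral) auto
    then have "G x \<le> (2 * \<epsilon> * W + (Q + 2 + C / P) / real (Suc j)) * P + 1 / real (Suc j) * E j"
      unfolding G_def using pt by (intro has_integral_le[OF integrable_integral[OF iG]])
    also have "\<dots> \<le> (2 * \<epsilon> * W + (Q + 2 + C / P) / real (Suc j)) * P + 1 / real (Suc j) * C"
      using C by (intro add_left_mono mult_left_mono) auto
    also have "\<dots> = 2 * \<epsilon> * (W * P) + C2 / real (Suc j)"
      by (simp add: C2_def add_divide_distrib algebra_simps del: of_nat_Suc)
    also have "C2 / real (Suc j) \<le> e / 2"
    proof -
      have "2 * C2 / e < real (Suc j)" using M' jn by (simp add: n_def)
      then show ?thesis using e by (simp add: field_simps del: of_nat_Suc)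
    qed
    also have "2 * \<epsilon> * (W * P) + e / 2 \<le> e" using \<open>4 * \<epsilon> * (W * P) \<le> e\<close> by linarith
    finally show ?thesis using x by auto
  qed
  moreover have contG: "continuous_on {0..a} G"
  proof -
    \<comment> \<open>Moving \<open>x\<close> to \<open>y\<close> changes each deviation by at most
      \<open>|N x - N y|\<close>, and the total weight is \<open>P\<close>.\<close>
    have G_lip: "dist (G x) (G y) \<le> P * dist (N x) (N y)" for x y
    proof -
      have *: "G x - G y \<le> P * dist (N x) (N y)" for x y
      proof -
        have "G x \<le> integral {0..a} (\<lambda>z. r z * norm (N z - N y) + dist (N x) (N y) * r z)"
          unfolding G_def
        proof (intro integral_le iG integrable_add integrable_on_mult_right ir)
          fix z assume "z \<in> {0..a}"
          then have "r z * norm (N z - N x) \<le> r z * (norm (N z - N y) + dist (N x) (N y))"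
            using r(2) by (intro mult_left_mono) (metis dist_norm dist_triangle2 dist_commute, auto)
          then show "r z * norm (N z - N x) \<le> r z * norm (N z - N y) + dist (N x) (N y) * r z"
            by (simp add: algebra_simps)
        qed
        also have "\<dots> = G y + dist (N x) (N y) * P"
          unfolding G_def P_def by (subst integral_add) (auto intro: iG integrable_on_mult_right ir)
        finally show ?thesis by (simp add: mult.commute)
      qed
      show ?thesis using *[of x y] *[of y x] by (simp add: dist_real_def dist_commute abs_le_iff)
    qed
    show ?thesis
      unfolding continuous_on_iff
    proof (intro ballI allI impI)
      fix x e :: real
      assume x: "x \<in> {0..a}" and e: "e > 0"
      obtain d where d: "d > 0" "\<And>y. y \<in> {0..a} \<Longrightarrow> dist y x < d \<Longrightarrow> dist (N y) (N x) < e / P"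
        using contN[unfolded continuous_on_iff, rule_format, OF x, of "e / P"] e P
        by (metis divide_pos_pos)
      show "\<exists>d>0. \<forall>y\<in>{0..a}. dist y x < d \<longrightarrow> dist (G y) (G x) < e"
      proof (intro exI[of _ d] conjI ballI impI d(1))
        fix y assume "y \<in> {0..a}" "dist y x < d"
        then have "P * dist (N y) (N x) < e" using d(2)[of y] P by (simp add: field_simps)
        then show "dist (G y) (G x) < e" using G_lip[of y x] by linarith
      qed
    qed
  qed
  \<comment> \<open>The points found so far depend on \<open>e\<close>. The minimum of the
    continuous \<open>G\<close> lies below every such \<open>e\<close>, so a single point
    \<open>x0\<close> has \<open>G x0 = 0\<close>.\<close>
  moreover obtain x0 where x0: "x0 \<in> {0..a}" "\<And>x. x \<in> {0..a} \<Longrightarrow> G x0 \<le> G x"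
    using continuous_attains_inf[OF compact_Icc _ contG] a
    by (metis atLeastatMost_empty_iff2 less_imp_le not_le)
  ultimately have "G x0 \<le> 0 + e" if "e > 0" for e using that by fastforce
  then have "G x0 \<le> 0" by (rule field_le_epsilon)
  moreover have "G x0 \<ge> 0" unfolding G_def using iG r(2) by (intro integral_nonneg) auto
  ultimately have "((\<lambda>y. r y * norm (N y - N x0)) has_integral 0) {0..a}"
    using integrable_integral[OF iG[of "N x0"]] by (simp add: G_def)
  then have "negligible {y \<in> {0..a}. r y * norm (N y - N x0) \<noteq> 0}"
    by (rule has_integral_zero_imp_negligible) (use r(2) in auto)
  then have "negligible ({y \<in> {0..a}. r y * norm (N y - N x0) \<noteq> 0} \<union> {t \<in> {0..a}. r t = 0})"
    using r0 by (rule negligible_Un)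
  then have "negligible {y \<in> {0..a}. N y \<noteq> N x0}"
    by (rule negligible_subset) auto
  then have Nconst: "N y = N x0" if "y \<in> {0..a}" for y
    using continuous_eq_if_negligible[OF a contN] that by blast
  moreover have "N 0 = 0" by (simp add: N_def I_def)
  ultimately have "N y = 0" if "y \<in> {0..a}" for y using that a by (metis atLeastAtMost_iff less_imp_le order_refl)
  then have "negligible {y \<in> {0..a}. of_real (w y) * g y \<noteq> 0}"
    by (intro integral_zero_imp_negligible iw g) (auto simp: N_def I_def)
  then have "negligible ({y \<in> {0..a}. of_real (w y) * g y \<noteq> 0} \<union> {t \<in> {0..a}. w t = 0})"
    using w0 by (rule negligible_Un)
  then have "negligible {y \<in> {0..a}. g y \<noteq> 0}"
    by (rule negligible_subset) auto
  then have g0: "g y = 0" if "y \<in> {0..a}" for y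
    using continuous_eq_if_negligible[OF a g] that by blast
  obtain M where "\<And>x. x \<in> {0..a} \<Longrightarrow> norm (u (k M) x - g x) < 1 / 2"
    using lim[of "1/2"] by fastforce
  then show False using umax[of "k M"] g0 by fastforce
qed

subsection \<open>Floquet solutions of the Sturm-Liouville equation\<close>

text \<open>The equation as a first-order system: \<open>r\<close> stands for \<open>1 / p\<close>, \<open>s\<close> for \<open>q - lam * w\<close>, and \<open>v\<close> for
  the quasi-derivative \<open>p u'\<close>.\<close>

definition sl_system ::
  "(real \<Rightarrow> real) \<Rightarrow> (real \<Rightarrow> complex) \<Rightarrow> (real \<Rightarrow> complex) \<Rightarrow> (real \<Rightarrow> complex) \<Rightarrow> bool" where
  "sl_system r s u v \<longleftrightarrow>
     (\<forall>c d. abs_continuous_on {c..d} u \<and> abs_continuous_on {c..d} v) \<and>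
     (\<exists>E. negligible E \<and> (\<forall>x. x \<notin> E \<longrightarrow>
        (u has_vector_derivative of_real (r x) * v x) (at x) \<and>
        (v has_vector_derivative s x * u x) (at x)))"

text \<open>Where \<open>p\<close> is positive and \<open>w\<close> nonzero, the equation can be
  solved for both derivatives. Setting the reciprocal of \<open>p\<close> to 0 elsewhere makes it
  nonnegative everywhere, as the energy estimates require, and alters it on a null set at
  most.\<close>

lemma sl_solution_imp_sl_system:
  assumes sol: "sl_solution w p q lam u v"
    and w: "AE x in lebesgue. w x \<noteq> 0" and p: "AE x in lebesgue. p x > 0"
  shows "sl_system (\<lambda>x. if p x > 0 then inverse (p x) else 0) (\<lambda>x. of_real (q x) - lam * of_real (w x)) u v"
proof -
  have "AE x in lebesgue. (u has_vector_derivative of_real (if p x > 0 then inverse (p x) else 0) * v x) (at x) \<and>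
        (v has_vector_derivative (of_real (q x) - lam * of_real (w x)) * u x) (at x)"
    using w p sol[unfolded sl_solution_def, THEN conjunct2, THEN conjunct2, THEN conjunct1]
      sol[unfolded sl_solution_def, THEN conjunct2, THEN conjunct2, THEN conjunct2]
  proof eventually_elim
    case (elim x)
    obtain u' where u': "(u has_vector_derivative u') (at x)" "v x = of_real (p x) * u'"
      using elim by blast
    obtain v' where v': "(v has_vector_derivative v') (at x)"
      "of_real (1 / w x) * (- v' + of_real (q x) * u x) = lam * u x"
      using elim by blast
    have "of_real (if p x > 0 then inverse (p x) else 0) * v x = u'"
      using elim u'(2) by (simp add: field_simps)
    moreover have "(of_real (q x) - lam * of_real (w x)) * u x = v'"
    proof -
      have "of_real (w x) * (of_real (1 / w x) * (- v' + of_real (q x) * u x)) = of_real (w x) * (lam * u x)"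
        using v'(2) by simp
      then have "- v' + of_real (q x) * u x = of_real (w x) * (lam * u x)"
        using elim by simp
      then show ?thesis by (simp add: algebra_simps eq_diff_eq add_eq_0_iff)
    qed
    ultimately show ?case using u'(1) v'(1) by simp
  qed
  from AE_imp_negligible[OF this] show ?thesis
    using sol unfolding sl_system_def sl_solution_def by blast
qed

lemma sl_system_lincomb:
  assumes "sl_system r s u1 v1" "sl_system r s u2 v2"
  shows "sl_system r s (\<lambda>x. \<alpha> * u1 x + \<beta> * u2 x) (\<lambda>x. \<alpha> * v1 x + \<beta> * v2 x)"
proof -
  obtain E1 E2 where E: "negligible E1" "negligible E2"
    and d1: "\<And>x. x \<notin> E1 \<Longrightarrow> (u1 has_vector_derivative of_real (r x) * v1 x) (at x)"
      "\<And>x. x \<notin> E1 \<Longrightarrow> (v1 has_vector_derivative s x * u1 x) (at x)"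
    and d2: "\<And>x. x \<notin> E2 \<Longrightarrow> (u2 has_vector_derivative of_real (r x) * v2 x) (at x)"
      "\<And>x. x \<notin> E2 \<Longrightarrow> (v2 has_vector_derivative s x * u2 x) (at x)"
    using assms unfolding sl_system_def by metis
  show ?thesis
    unfolding sl_system_def
  proof (intro conjI allI exI[of _ "E1 \<union> E2"] impI)
    fix x assume x: "x \<notin> E1 \<union> E2"
    show "((\<lambda>x. \<alpha> * u1 x + \<beta> * u2 x) has_vector_derivative of_real (r x) * (\<alpha> * v1 x + \<beta> * v2 x)) (at x)"
      using x by (auto intro!: derivative_eq_intros d1 d2 simp: algebra_simps)
    show "((\<lambda>x. \<alpha> * v1 x + \<beta> * v2 x) has_vector_derivative s x * (\<alpha> * u1 x + \<beta> * u2 x)) (at x)"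
      using x by (auto intro!: derivative_eq_intros d1 d2 simp: algebra_simps)
  qed (use E assms in \<open>auto simp: sl_system_def intro!: abs_continuous_on_add abs_continuous_on_cmult\<close>)
qed

lemma sl_system_continuous_on:
  assumes "sl_system r s u v"
  shows "continuous_on {c..d} u" "continuous_on {c..d} v"
  using assms by (auto simp: sl_system_def intro: abs_continuous_on_imp_continuous_on)

text \<open>The third identity is the energy identity: since \<open>r\<close> is real,
  \<open>cnj u\<close> has derivative \<open>r * cnj v\<close> almost everywhere, and the product
  rule for \<open>v * cnj u\<close> gives the integrand.\<close>

lemma sl_system_has_integral:
  assumes "sl_system r s u v" "x \<le> y"
  shows "((\<lambda>t. of_real (r t) * v t) has_integral (u y - u x)) {x..y}"
    and "((\<lambda>t. s t * u t) has_integral (v y - v x)) {x..y}"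
    and "((\<lambda>t. of_real (r t * (norm (v t))\<^sup>2) + s t * of_real ((norm (u t))\<^sup>2))
           has_integral (v y * cnj (u y) - v x * cnj (u x))) {x..y}"
proof -
  have ac: "abs_continuous_on {x..y} u" "abs_continuous_on {x..y} v"
    using assms(1) by (auto simp: sl_system_def)
  obtain E where E: "negligible E"
    and d: "\<And>x. x \<notin> E \<Longrightarrow> (u has_vector_derivative of_real (r x) * v x) (at x)"
      "\<And>x. x \<notin> E \<Longrightarrow> (v has_vector_derivative s x * u x) (at x)"
    using assms(1) unfolding sl_system_def by metis
  show "((\<lambda>t. of_real (r t) * v t) has_integral (u y - u x)) {x..y}"
    by (rule abs_continuous_on_has_integral[OF assms(2) ac(1) E])
      (auto intro: d has_vector_derivative_at_within)
  show "((\<lambda>t. s t * u t) has_integral (v y - v x)) {x..y}"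
    by (rule abs_continuous_on_has_integral[OF assms(2) ac(2) E])
      (auto intro: d has_vector_derivative_at_within)
  show "((\<lambda>t. of_real (r t * (norm (v t))\<^sup>2) + s t * of_real ((norm (u t))\<^sup>2))
           has_integral (v y * cnj (u y) - v x * cnj (u x))) {x..y}"
  proof (rule abs_continuous_on_has_integral[OF assms(2) _ E])
    show "abs_continuous_on {x..y} (\<lambda>t. v t * cnj (u t))"
      by (intro abs_continuous_on_mult abs_continuous_on_cnj ac)
    fix t assume t: "t \<in> {x..y} - E"
    have "((\<lambda>t. v t * cnj (u t)) has_vector_derivative v t * cnj (of_real (r t) * v t) + s t * u t * cnj (u t)) (at t)"
      by (intro has_vector_derivative_mult has_vector_derivative_cnj d) (use t in auto)
    also have "v t * cnj (of_real (r t) * v t) + s t * u t * cnj (u t)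
        = of_real (r t) * (v t * cnj (v t)) + s t * (u t * cnj (u t))"
      by (simp add: algebra_simps)
    also have "\<dots> = of_real (r t * (norm (v t))\<^sup>2) + s t * of_real ((norm (u t))\<^sup>2)"
      by (simp only: complex_norm_square of_real_mult)
    finally show "((\<lambda>t. v t * cnj (u t)) has_vector_derivative
        of_real (r t * (norm (v t))\<^sup>2) + s t * of_real ((norm (u t))\<^sup>2)) (at t within {x..y})"
      by (rule has_vector_derivative_at_within)
  qed
qed

text \<open>In the derivative of the Wronskian the terms with \<open>s\<close> and those with
  \<open>r\<close> cancel in pairs. Absolute continuity is what turns a derivative vanishing almost
  everywhere into constancy. For the fundamental solutions this is the determinant of the monodromy
  matrix.\<close>

lemma sl_system_wronskian:
  assumes "sl_system r s u1 v1" "sl_system r s u2 v2" "x \<le> y"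
  shows "u1 y * v2 y - u2 y * v1 y = u1 x * v2 x - u2 x * v1 x"
proof -
  obtain E1 E2 where E: "negligible E1" "negligible E2"
    and d1: "\<And>x. x \<notin> E1 \<Longrightarrow> (u1 has_vector_derivative of_real (r x) * v1 x) (at x)"
      "\<And>x. x \<notin> E1 \<Longrightarrow> (v1 has_vector_derivative s x * u1 x) (at x)"
    and d2: "\<And>x. x \<notin> E2 \<Longrightarrow> (u2 has_vector_derivative of_real (r x) * v2 x) (at x)"
      "\<And>x. x \<notin> E2 \<Longrightarrow> (v2 has_vector_derivative s x * u2 x) (at x)"
    using assms(1,2) unfolding sl_system_def by metis
  define W where "W = (\<lambda>t. u1 t * v2 t + (- 1) * (u2 t * v1 t))"
  have "((\<lambda>t. 0) has_integral (W y - W x)) {x..y}"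
  proof (rule abs_continuous_on_has_integral[OF assms(3), of _ "E1 \<union> E2"])
    show "abs_continuous_on {x..y} W"
      unfolding W_def using assms(1,2)
      by (intro abs_continuous_on_mult abs_continuous_on_add abs_continuous_on_cmult) (auto simp: sl_system_def)
    fix t assume t: "t \<in> {x..y} - (E1 \<union> E2)"
    have "(W has_vector_derivative (u1 t * (s t * u2 t) + of_real (r t) * v1 t * v2 t)
        + (- 1) * (u2 t * (s t * u1 t) + of_real (r t) * v2 t * v1 t)) (at t)"
      unfolding W_def
      by (intro has_vector_derivative_mult has_vector_derivative_add
          bounded_linear.has_vector_derivative[OF bounded_linear_mult_right] d1 d2) (use t in auto)
    then have "(W has_vector_derivative 0) (at t)" by (simp add: algebra_simps)
    then show "(W has_vector_derivative 0) (at t within {x..y})" by (rule has_vector_derivative_at_within)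
  qed (use E in auto)
  then show ?thesis by (simp add: W_def)
qed

section \<open>Multipliers and eigenvectors of the monodromy matrix\<close>

lemma floquet_vector:
  fixes A B C D :: complex
  assumes det: "A * D - B * C = 1" and \<rho>: "\<rho>\<^sup>2 - (A + D) * \<rho> + 1 = 0"
  obtains \<alpha> \<beta> where "\<alpha> \<noteq> 0 \<or> \<beta> \<noteq> 0" "\<alpha> * A + \<beta> * B = \<rho> * \<alpha>" "\<alpha> * C + \<beta> * D = \<rho> * \<beta>"
proof -
  have char: "(\<rho> - A) * (\<rho> - D) = B * C"
  proof -
    have "(\<rho> - A) * (\<rho> - D) = \<rho>\<^sup>2 - (A + D) * \<rho> + A * D" by (simp add: algebra_simps power2_eq_square)
    also have "\<dots> = (\<rho>\<^sup>2 - (A + D) * \<rho> + 1) + (A * D - B * C - 1) + B * C" by simp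
    also have "\<dots> = B * C" by (simp only: det \<rho>) simp
    finally show ?thesis .
  qed
  \<comment> \<open>If \<open>B\<close> or \<open>C\<close> is nonzero, the eigenvector is read off
    from the row of the singular matrix containing that entry, and \<open>char\<close> settles the
    other row. Otherwise the matrix is diagonal and a unit vector works.\<close>
  consider "B \<noteq> 0" | "C \<noteq> 0" | "B = 0" "C = 0" "\<rho> = A" | "B = 0" "C = 0" "\<rho> = D"
    using char by fastforce
  then show thesis
  proof cases
    case 1
    show thesis
      by (rule that[of B "\<rho> - A"]) (use 1 char in \<open>simp_all add: algebra_simps\<close>)
  next
    case 2
    show thesis
      by (rule that[of "\<rho> - D" C]) (use 2 char in \<open>simp_all add: algebra_simps\<close>)
  next
    case 3
    show thesis by (rule that[of 1 0]) (use 3 in simp_all)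
  next
    case 4
    show thesis by (rule that[of 0 1]) (use 4 in simp_all)
  qed
qed

lemma floquet_multiplier:
  fixes c :: complex
  obtains \<rho> where "\<rho> \<noteq> 0" "\<rho>\<^sup>2 - c * \<rho> + 1 = 0"
proof -
  define d where "d = csqrt (c\<^sup>2 - 4)"
  define \<rho> where "\<rho> = (c + d) / 2"
  have "\<rho>\<^sup>2 - c * \<rho> + 1 = (d\<^sup>2 - c\<^sup>2 + 4) / 4"
    unfolding \<rho>_def by (simp add: power2_eq_square field_simps)
  also have "\<dots> = 0" by (simp add: d_def)
  finally have "\<rho>\<^sup>2 - c * \<rho> + 1 = 0" .
  moreover from this have "\<rho> \<noteq> 0" by auto
  ultimately show thesis using that by blast
qed

text \<open>The values of the fundamental solutions at \<open>a\<close> form the monodromy matrix,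
  whose trace is the discriminant. An eigenvector for \<open>\<rho>\<close> supplies the initial
  values of \<open>u\<close> and \<open>v\<close>.\<close>

lemma floquet_solution:
  fixes \<rho> :: complex
  assumes a: "a > 0" and \<phi>: "sl_system r s \<phi> p\<phi>'" and \<psi>: "sl_system r s \<psi> p\<psi>'"
    and init: "\<phi> 0 = 1" "p\<phi>' 0 = 0" "\<psi> 0 = 0" "p\<psi>' 0 = 1"
    and \<rho>: "\<rho>\<^sup>2 - (\<phi> a + p\<psi>' a) * \<rho> + 1 = 0"
    and r0: "negligible {t \<in> {0..a}. r t = 0}"
  obtains u v where "sl_system r s u v" "u a = \<rho> * u 0" "v a = \<rho> * v 0"
    "\<And>t. t \<in> {0..a} \<Longrightarrow> norm (u t) \<le> 1" "\<exists>t\<in>{0..a}. norm (u t) = 1"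
proof -
  have "\<phi> a * p\<psi>' a - \<psi> a * p\<phi>' a = 1"
    using sl_system_wronskian[OF \<phi> \<psi>, of 0 a] a init by simp
  from floquet_vector[OF this \<rho>]
  obtain \<alpha> \<beta> where nz: "\<alpha> \<noteq> 0 \<or> \<beta> \<noteq> 0"
    and ev: "\<alpha> * \<phi> a + \<beta> * \<psi> a = \<rho> * \<alpha>" "\<alpha> * p\<phi>' a + \<beta> * p\<psi>' a = \<rho> * \<beta>"
    by blast
  define u v where "u = (\<lambda>x. \<alpha> * \<phi> x + \<beta> * \<psi> x)" and "v = (\<lambda>x. \<alpha> * p\<phi>' x + \<beta> * p\<psi>' x)"
  have uv: "sl_system r s u v" unfolding u_def v_def by (rule sl_system_lincomb[OF \<phi> \<psi>])
  have u0: "u 0 = \<alpha>" "v 0 = \<beta>" "u a = \<rho> * \<alpha>" "v a = \<rho> * \<beta>"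
    using init ev by (simp_all add: u_def v_def)
  have "continuous_on {0..a} (\<lambda>t. norm (u t))"
    by (intro continuous_on_norm sl_system_continuous_on[OF uv])
  then obtain x0 where x0: "x0 \<in> {0..a}" "\<And>t. t \<in> {0..a} \<Longrightarrow> norm (u t) \<le> norm (u x0)"
    using continuous_attains_sup[OF compact_Icc[of 0 a]] a by (metis atLeastatMost_empty_iff2 less_imp_le not_le)
  \<comment> \<open>Normalising by \<open>u\<close> alone is legitimate: if \<open>u\<close>
    vanished on the whole period, all integrals of \<open>r * v\<close> from 0 would vanish. So
    \<open>v\<close> would be zero too, against the nontrivial initial values.\<close>
  have ux0: "u x0 \<noteq> 0"
  proof
    assume "u x0 = 0"
    then have uz: "u t = 0" if "t \<in> {0..a}" for t using x0(2)[OF that] by simp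
    have "negligible {t \<in> {0..a}. of_real (r t) * v t \<noteq> 0}"
    proof (rule integral_zero_imp_negligible)
      show "(\<lambda>t. of_real (r t) * v t) integrable_on {0..a}"
        using sl_system_has_integral(1)[OF uv, of 0 a] a by (auto simp: integrable_on_def)
      fix x assume "x \<in> {0..a}"
      then show "integral {0..x} (\<lambda>t. of_real (r t) * v t) = 0"
        using sl_system_has_integral(1)[OF uv, of 0 x] uz a by (auto simp: integral_unique)
    qed
    then have "negligible ({t \<in> {0..a}. of_real (r t) * v t \<noteq> 0} \<union> {t \<in> {0..a}. r t = 0})"
      using r0 by (rule negligible_Un)
    then have "negligible {t \<in> {0..a}. v t \<noteq> 0}" by (rule negligible_subset) auto
    then have "v 0 = 0"
      by (rule continuous_eq_if_negligible[OF a sl_system_continuous_on(2)[OF uv]]) (use a in simp)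
    moreover have "u 0 = 0" using uz a by simp
    ultimately show False using nz u0 by simp
  qed
  define c where "c = inverse (u x0)"
  show thesis
  \<comment> \<open>The zero summands present the scalar multiple as a linear combination, so that
    \<open>sl_system_lincomb\<close> applies.\<close>
  proof (rule that[of "\<lambda>x. c * u x + 0 * u x" "\<lambda>x. c * v x + 0 * v x"])
    show "sl_system r s (\<lambda>x. c * u x + 0 * u x) (\<lambda>x. c * v x + 0 * v x)"
      by (rule sl_system_lincomb[OF uv uv])
    show "norm (c * u t + 0 * u t) \<le> 1" if "t \<in> {0..a}" for t
      using x0(2)[OF that] ux0 by (simp add: c_def norm_divide flip: divide_inverse_commute)
    show "\<exists>t\<in>{0..a}. norm (c * u t + 0 * u t) = 1"
      using x0(1) ux0 by (intro bexI[of _ x0]) (simp_all add: c_def)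
  qed (use u0 in simp_all)
qed

theorem corollary2p4:
  fixes a :: real
    and w p q :: "real \<Rightarrow> real"
    and \<phi> p\<phi>' \<psi> p\<psi>' :: "complex \<Rightarrow> real \<Rightarrow> complex"
    and D :: "complex \<Rightarrow> complex"
  assumes "a > 0"
    and "w \<in> borel_measurable lebesgue"
    and "p \<in> borel_measurable lebesgue"
    and "q \<in> borel_measurable lebesgue"
    and "\<And>x. w (x + a) = w x"
    and "\<And>x. p (x + a) = p x"
    and "\<And>x. q (x + a) = q x"
    and "w absolutely_integrable_on {0<..<a}"
    and "q absolutely_integrable_on {0<..<a}"
    and "(\<lambda>x. inverse (p x)) absolutely_integrable_on {0<..<a}"
    and "AE x in lebesgue. w x \<noteq> 0"
    and "AE x in lebesgue. p x > 0"
    and "\<And>lam. sl_solution w p q lam (\<phi> lam) (p\<phi>' lam)"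
    and "\<And>lam. \<phi> lam 0 = 1"
    and "\<And>lam. p\<phi>' lam 0 = 0"
    and "\<And>lam. sl_solution w p q lam (\<psi> lam) (p\<psi>' lam)"
    and "\<And>lam. \<psi> lam 0 = 0"
    and "\<And>lam. p\<psi>' lam 0 = 1"
    and "\<And>lam. D lam = \<phi> lam a + p\<psi>' lam a"
  shows "\<not> D constant_on UNIV"
proof
  assume "D constant_on UNIV"
  then obtain c where "\<And>lam. D lam = c" by (auto simp: constant_on_def)
  then have c: "\<phi> lam a + p\<psi>' lam a = c" for lam using assms(19) by metis
  obtain \<rho> where \<rho>: "\<rho> \<noteq> 0" "\<rho>\<^sup>2 - c * \<rho> + 1 = 0" by (rule floquet_multiplier)
  define r where "r = (\<lambda>x. if p x > 0 then inverse (p x) else 0)"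
  define s where "s = (\<lambda>n x. complex_of_real (q x) - \<i> * of_real (real (Suc n)) * of_real (w x))"
  have p0: "negligible {x. \<not> p x > 0}" and w0: "negligible {x. \<not> w x \<noteq> 0}"
    by (rule AE_imp_negligible[OF assms(12)], rule AE_imp_negligible[OF assms(11)])
  have r0: "negligible {t \<in> {0..a}. r t = 0}"
    by (rule negligible_subset[OF p0]) (auto simp: r_def)
  have sl: "sl_system r (s n) (\<phi> (\<i> * of_real (real (Suc n)))) (p\<phi>' (\<i> * of_real (real (Suc n))))"
    "sl_system r (s n) (\<psi> (\<i> * of_real (real (Suc n)))) (p\<psi>' (\<i> * of_real (real (Suc n))))" for n
    unfolding r_def s_def by (intro sl_solution_imp_sl_system assms)+
  have "\<exists>u v. sl_system r (s n) u v \<and> u a = \<rho> * u 0 \<and> v a = \<rho> * v 0 \<and>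
      (\<forall>t\<in>{0..a}. norm (u t) \<le> 1) \<and> (\<exists>t\<in>{0..a}. norm (u t) = 1)" for n
    using floquet_solution[OF assms(1) sl[of n] assms(14,15,17,18) _ r0, of \<rho>] \<rho>(2) c by metis
  then obtain u v where uv: "\<And>n. sl_system r (s n) (u n) (v n)"
    "\<And>n. u n a = \<rho> * u n 0" "\<And>n. v n a = \<rho> * v n 0"
    "\<And>n t. t \<in> {0..a} \<Longrightarrow> norm (u n t) \<le> 1" "\<And>n. \<exists>t\<in>{0..a}. norm (u n t) = 1"
    by metis
  note int = sl_system_has_integral[OF uv(1)]
  show False
  proof (rule no_floquet_sequence[of a r q w u v \<rho>])
    show "r absolutely_integrable_on {0..a}"
    proof (rule absolutely_integrable_spike[OF _ p0])
      show "(\<lambda>x. inverse (p x)) absolutely_integrable_on {0..a}"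
        using assms(10) by (simp add: absolutely_integrable_on_Icc_iff_Ioo)
    qed (auto simp: r_def)
    show "negligible {t \<in> {0..a}. w t = 0}"
      by (rule negligible_subset[OF w0]) auto
    show "w absolutely_integrable_on {0..a}" "q absolutely_integrable_on {0..a}"
      using assms(8,9) by (simp_all add: absolutely_integrable_on_Icc_iff_Ioo)
    show "continuous_on {0..a} (u n)" "continuous_on {0..a} (v n)" for n
      using sl_system_continuous_on[OF uv(1)] by auto
  qed (use assms(1) uv(2-5) r0 \<rho>(1) int[unfolded s_def] in \<open>auto simp: r_def\<close>)
qed

end
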